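(* Let $A\in\mathbb R^{n\times n}$ be symmetric positive definite, let $N$, $n_s$, $R_s$, $\tilde A_s$ ($s=1,\dots,N$) satisfy the local setting and let $V_0$, $R_0$ satisfy the coarse setting (both described in the context), with associated operators $H$ and $P_0$. Assume that $$\sum_{s=1}^NR_s^\top\operatorname{Ker}(\tilde A_s)\subset V_0.$$ Let $C_0>0$ be a constant such that, for any $x\in\operatorname{range}(P_0)$, there exist $z_1\in\mathbb R^{n_1},\dots,z_N\in\mathbb R^{n_N}$ with $$x=\sum_{s=1}^NP_0R_s^\top z_s\quad\text{and}\quad\sum_{s=1}^N\langle z_s,\tilde A_sz_s\rangle\le C_0^2\langle x,Ax\rangle.$$ Then the smallest eigenvalue $\lambda_{\min}$ of $HAP_0$, excluding zero, satisfies $\lambda_{\min}\ge C_0^{-2}$.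
   Context: Abbreviations: spd = symmetric positive definite, spsd = symmetric positive semi-definite. $B^\dagger$ is the Moore-Penrose pseudo-inverse. $\langle x,y\rangle=x^\top y$. Local setting: $N\in\mathbb N$ is the number of subdomains, and for each $s\in\{1,\dots,N\}$, $n_s\in\mathbb N$, $R_s\in\mathbb R^{n_s\times n}$ and $\tilde A_s\in\mathbb R^{n_s\times n_s}$ are such that: $R_sR_s^\top=I$; $\mathbb R^n=\sum_{s=1}^N\operatorname{range}(R_s^\top)$; each $\tilde A_s$ is spsd; and $H:=\sum_{s=1}^NR_s^\top\tilde A_s^\dagger R_s$ is non-singular (hence spd). Coarse setting: $V_0\subset\mathbb R^n$ is a subspace (the coarse space) and $R_0\in\mathbb R^{\dim(V_0)\times n}$ is a matrix whose rows form a basis of $V_0$, so $V_0=\operatorname{range}(R_0^\top)$. The operator $P_0:=I-R_0^\top(R_0AR_0^\top)^{-1}R_0A$ is the $A$-orthogonal projection with $\operatorname{Ker}(P_0)=V_0$. *)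

theory Defs
  imports
    "Jordan_Normal_Form.Matrix_Kernel"
    "Jordan_Normal_Form.Gauss_Jordan_Elimination"
    "Jordan_Normal_Form.Spectral_Radius"
begin

definition spd_mat :: "nat \<Rightarrow> real mat \<Rightarrow> bool" where
  "spd_mat n A \<longleftrightarrow> A \<in> carrier_mat n n \<and> A\<^sup>T = A \<and>
     (\<forall>x \<in> carrier_vec n. x \<noteq> 0\<^sub>v n \<longrightarrow> x \<bullet> (A *\<^sub>v x) > 0)"

definition spsd_mat :: "nat \<Rightarrow> real mat \<Rightarrow> bool" where
  "spsd_mat n A \<longleftrightarrow> A \<in> carrier_mat n n \<and> A\<^sup>T = A \<and>
     (\<forall>x \<in> carrier_vec n. x \<bullet> (A *\<^sub>v x) \<ge> 0)"

definition is_pseudo_inverse :: "real mat \<Rightarrow> real mat \<Rightarrow> bool" where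
  "is_pseudo_inverse B X \<longleftrightarrow> X \<in> carrier_mat (dim_col B) (dim_row B) \<and>
     B * X * B = B \<and> X * B * X = X \<and> (B * X)\<^sup>T = B * X \<and> (X * B)\<^sup>T = X * B"

(* The Penrose conditions have exactly one solution for every real matrix B. *)
definition pseudo_inverse :: "real mat \<Rightarrow> real mat" where
  "pseudo_inverse B = (THE X. is_pseudo_inverse B X)"

definition mat_range :: "real mat \<Rightarrow> real vec set" where
  "mat_range M = (\<lambda>x. M *\<^sub>v x) ` carrier_vec (dim_col M)"

definition sum_of_sets :: "nat \<Rightarrow> 'i set \<Rightarrow> ('i \<Rightarrow> real vec set) \<Rightarrow> real vec set" where
  "sum_of_sets n I W = {finsum_vec TYPE(real) n w I | w. \<forall>i \<in> I. w i \<in> W i}"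

definition schwarz_op :: "nat \<Rightarrow> nat \<Rightarrow> (nat \<Rightarrow> real mat) \<Rightarrow> (nat \<Rightarrow> real mat) \<Rightarrow> real mat" where
  "schwarz_op n N R At =
     finsum (module_mat TYPE(real) n n) (\<lambda>s. (R s)\<^sup>T * pseudo_inverse (At s) * R s) {1..N}"

(* The subdomain dimensions are d 1, ..., d N; values of d, R, At outside {1..N} are irrelevant. *)
definition local_setting ::
  "nat \<Rightarrow> nat \<Rightarrow> (nat \<Rightarrow> nat) \<Rightarrow> (nat \<Rightarrow> real mat) \<Rightarrow> (nat \<Rightarrow> real mat) \<Rightarrow> bool" where
  "local_setting n N d R At \<longleftrightarrow>
     (\<forall>s \<in> {1..N}. R s \<in> carrier_mat (d s) n \<and> R s * (R s)\<^sup>T = 1\<^sub>m (d s) \<and> spsd_mat (d s) (At s)) \<and>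
     carrier_vec n = sum_of_sets n {1..N} (\<lambda>s. mat_range ((R s)\<^sup>T)) \<and>
     invertible_mat (schwarz_op n N R At)"

(* R0 has dim V0 rows, so a set of rows that is a basis of V0 has no repeated row. *)
definition coarse_setting :: "nat \<Rightarrow> real vec set \<Rightarrow> real mat \<Rightarrow> bool" where
  "coarse_setting n V0 R0 \<longleftrightarrow>
     VectorSpace.subspace class_ring V0 (module_vec TYPE(real) n) \<and>
     (let W = (module_vec TYPE(real) n)\<lparr>carrier := V0\<rparr>
      in R0 \<in> carrier_mat (vectorspace.dim class_ring W) n \<and>
         vectorspace.basis class_ring W (set (rows R0)))"

(* mat_inverse returns None on singular matrices; if A is spd and the rows of R0 are
   linearly independent then R0 A R0^T is invertible. *)
definition coarse_proj :: "nat \<Rightarrow> real mat \<Rightarrow> real mat \<Rightarrow> real mat" where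
  "coarse_proj n A R0 = 1\<^sub>m n - R0\<^sup>T * the (mat_inverse (R0 * A * R0\<^sup>T)) * R0 * A"

(* Eigenvalues are taken over the complex numbers, so that the existence of a least one
   among the nonzero eigenvalues includes that all of these are real. *)
definition is_least_nonzero_eigenvalue :: "real mat \<Rightarrow> real \<Rightarrow> bool" where
  "is_least_nonzero_eigenvalue M l \<longleftrightarrow>
     (let S = spectrum (map_mat complex_of_real M) - {0}
      in complex_of_real l \<in> S \<and> (\<forall>\<mu> \<in> S. \<mu> \<in> \<real> \<and> l \<le> Re \<mu>))"

end

theory Submission
  imports Defs "Jordan_Normal_Form.DL_Rank"
begin

text \<open>Let \<open>H A P v = l v\<close> with \<open>l \<noteq> 0\<close>, and put \<open>x = P v \<noteq> 0\<close> and \<open>w\<^sub>s = At\<^sub>s\<^sup>\<dagger> R\<^sub>s A x\<close>. The kernel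
  assumption gives \<open>At\<^sub>s w\<^sub>s = R\<^sub>s A x\<close>, so the stable decomposition \<open>x = \<Sum> P R\<^sub>s\<^sup>T z\<^sub>s\<close> yields
  \<open>\<langle>x, A x\<rangle> = \<Sum> \<langle>z\<^sub>s, At\<^sub>s w\<^sub>s\<rangle>\<close>, while \<open>\<Sum> \<langle>w\<^sub>s, At\<^sub>s w\<^sub>s\<rangle> = \<langle>A x, H A x\<rangle> = l \<langle>x, A x\<rangle>\<close>. The
  Cauchy-Schwarz inequality for the forms \<open>At\<^sub>s\<close> gives \<open>1 \<le> C0\<^sup>2 l\<close>. A least nonzero eigenvalue exists
  because \<open>H A P\<close> is nonzero and self-adjoint for the inner product defined by \<open>H\<^sup>-\<^sup>1\<close>: its spectrum
  is real, and it is not nilpotent.\<close>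

section \<open>Elementary linear algebra: inverses, symmetry and scalar products\<close>

text \<open>A trivial kernel makes the determinant nonzero. The inverse is tied to
  \<open>mat_inverse\<close> because \<open>coarse_proj\<close> is defined through that
  function.\<close>

lemma injective_mat_inverse:
  fixes A :: "'a :: field mat"
  assumes A: "A \<in> carrier_mat n n"
    and inj: "\<And>v. v \<in> carrier_vec n \<Longrightarrow> A *\<^sub>v v = 0\<^sub>v n \<Longrightarrow> v = 0\<^sub>v n"
  obtains B where "B \<in> carrier_mat n n" "A * B = 1\<^sub>m n" "B * A = 1\<^sub>m n" "mat_inverse A = Some B"
proof -
  have "det A \<noteq> 0"
    using det_0_iff_vec_prod_zero_field[OF A] inj by blast
  then have "A \<in> Units (ring_mat TYPE('a) n ())"
    by (rule det_non_zero_imp_unit[OF A])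
  then obtain B where "mat_inverse A = Some B"
    using mat_inverse(1)[OF A, of "()"] by (cases "mat_inverse A") auto
  then show thesis
    using mat_inverse(2)[OF A] that by blast
qed

lemma scalar_prod_mult_mat_vec_comm:
  fixes B :: "real mat"
  assumes "B \<in> carrier_mat n n" "B\<^sup>T = B" "x \<in> carrier_vec n" "y \<in> carrier_vec n"
  shows "x \<bullet> (B *\<^sub>v y) = (B *\<^sub>v x) \<bullet> y" "x \<bullet> (B *\<^sub>v y) = y \<bullet> (B *\<^sub>v x)"
proof -
  show "x \<bullet> (B *\<^sub>v y) = (B *\<^sub>v x) \<bullet> y"
    using transpose_vec_mult_scalar[of B n n y x] assms by simp
  then show "x \<bullet> (B *\<^sub>v y) = y \<bullet> (B *\<^sub>v x)"
    using assms comm_scalar_prod[of "B *\<^sub>v x" n y] by simp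
qed

lemma mult_mat_zero_vec: "A \<in> carrier_mat n m \<Longrightarrow> A *\<^sub>v 0\<^sub>v m = 0\<^sub>v n"
  for A :: "'a :: semiring_1 mat"
  by (intro eq_vecI) auto

lemma zero_mult_mat_vec: "x \<in> carrier_vec m \<Longrightarrow> 0\<^sub>m n m *\<^sub>v x = 0\<^sub>v n"
  for x :: "'a :: semiring_1 vec"
  by auto

lemma minus_vec_eq_0:
  fixes x y :: "real vec"
  assumes x: "x \<in> carrier_vec n" and y: "y \<in> carrier_vec n" and 0: "x - y = 0\<^sub>v n"
  shows "x = y"
proof (rule eq_vecI)
  fix i assume "i < dim_vec y"
  then have i: "i < n" using y by simp
  have "(x - y) $ i = 0" unfolding 0 using i by simp
  then show "x $ i = y $ i" using i x y by simp
qed (use x y in simp)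

lemma mult_mult_mat_vec:
  assumes "A \<in> carrier_mat k l" "B \<in> carrier_mat l m" "C \<in> carrier_mat m n" "v \<in> carrier_vec n"
  shows "(A * B * C) *\<^sub>v v = A *\<^sub>v (B *\<^sub>v (C *\<^sub>v v))"
  using assms assoc_mult_mat_vec[OF mult_carrier_mat[OF assms(1,2)] assms(3,4)]
    assoc_mult_mat_vec[OF assms(1,2) mult_mat_vec_carrier[OF assms(3,4)]]
  by (simp del: assoc_mult_mat)


text \<open>Unit vectors recover the entries from the bilinear form, so symmetry of a composite
  operator can be read off from its form.\<close>

lemma symmetric_matI:
  fixes B :: "real mat"
  assumes B: "B \<in> carrier_mat n n"
    and sym: "\<And>x y. x \<in> carrier_vec n \<Longrightarrow> y \<in> carrier_vec n \<Longrightarrow> x \<bullet> (B *\<^sub>v y) = y \<bullet> (B *\<^sub>v x)"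
  shows "B\<^sup>T = B"
proof (rule eq_matI)
  fix i j assume ij: "i < dim_row B" "j < dim_col B"
  then have ij: "i < n" "j < n" using B by auto
  have e: "unit_vec n k \<bullet> (B *\<^sub>v unit_vec n l) = B $$ (k, l)" if "k < n" "l < n" for k l
    using that B by simp
  show "B\<^sup>T $$ (i, j) = B $$ (i, j)"
    using sym[of "unit_vec n i" "unit_vec n j"] e[of i j] e[of j i] ij B by simp
qed (use B in auto)

lemma scalar_prod_self_eq_0:
  fixes x :: "real vec"
  assumes "x \<in> carrier_vec n"
  shows "x \<bullet> x = 0 \<longleftrightarrow> x = 0\<^sub>v n"
proof
  assume "x \<bullet> x = 0"
  then have "x $ i = 0" if "i < n" for i
    using that assms by (simp add: scalar_prod_def sum_nonneg_eq_0_iff)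
  then show "x = 0\<^sub>v n" using assms by (intro eq_vecI) auto
qed (use assms in simp)

lemma mat_eq_if_mult_mat_vec_eq:
  fixes A B :: "'a :: semiring_1 mat"
  assumes A: "A \<in> carrier_mat n m" and B: "B \<in> carrier_mat n m"
    and eq: "\<And>x. x \<in> carrier_vec m \<Longrightarrow> A *\<^sub>v x = B *\<^sub>v x"
  shows "A = B"
proof (rule eq_matI)
  fix i j assume "i < dim_row B" "j < dim_col B"
  then have ij: "i < n" "j < m" using B by auto
  have "C $$ (i, j) = (C *\<^sub>v unit_vec m j) $ i" if "C \<in> carrier_mat n m" for C :: "'a mat"
    using that ij by simp
  then show "A $$ (i, j) = B $$ (i, j)" using A B eq[of "unit_vec m j"] by simp
qed (use A B in auto)

section \<open>The Moore-Penrose pseudo-inverse of a symmetric matrix\<close>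

text \<open>The columns of \<open>N\<close> list a finite basis of the kernel.\<close>

lemma mat_kernel_eq_range:
  fixes B :: "real mat"
  assumes B: "B \<in> carrier_mat n n"
  obtains m N where "N \<in> carrier_mat n m" "mat_kernel B = mat_range N"
proof -
  interpret kernel n n B by unfold_locales (rule B)
  obtain W where W: "finite W" "basis W" using kernel_basis_exists[OF B] by blast
  then have sub: "W \<subseteq> mat_kernel B" and span: "span W = mat_kernel B"
    unfolding Ker.basis_def by auto
  obtain ws where ws: "set ws = W" using \<open>finite W\<close> finite_list by blast
  let ?N = "mat_of_cols n ws"
  have Wc: "W \<subseteq> carrier_vec n" using sub mat_kernel_carrier[OF B] by blast
  have N: "?N \<in> carrier_mat n (length ws)" by simp
  have "mat_kernel B = NC.span W" using span span_same[OF sub] by simp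
  also have "\<dots> = NC.col_space ?N"
    unfolding NC.col_space_def using ws Wc by (simp add: cols_mat_of_cols)
  also have "\<dots> = mat_range ?N"
    unfolding NC.col_space_eq[OF N] mat_range_def using mult_mat_vec_carrier[OF N] by auto
  finally show thesis using that N by blast
qed

text \<open>With \<open>ker B = range N\<close>, the matrix \<open>B + N N\<^sup>T\<close> is invertible because \<open>range B\<close> and
  \<open>ker B\<close> are orthogonal; \<open>S\<close> is its inverse.\<close>

lemma symmetric_mat_factor_through_square:
  fixes B :: "real mat"
  assumes B: "B \<in> carrier_mat n n" and sym: "B\<^sup>T = B"
  obtains S where "S \<in> carrier_mat n n" "B * (B * S) = B"
proof -
  obtain m N where N: "N \<in> carrier_mat n m" and ker: "mat_kernel B = mat_range N"
    using mat_kernel_eq_range[OF B] .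
  have NT: "N\<^sup>T \<in> carrier_mat m n" using N by simp
  let ?G = "N * N\<^sup>T"
  have G: "?G \<in> carrier_mat n n" using N by simp
  have BN: "B *\<^sub>v (N *\<^sub>v y) = 0\<^sub>v n" if "y \<in> carrier_vec m" for y
    using ker that mat_kernelD(2)[OF B, of "N *\<^sub>v y"] N unfolding mat_range_def by auto
  have BG: "B * ?G = 0\<^sub>m n n"
  proof (rule mat_eq_if_mult_mat_vec_eq)
    fix x :: "real vec" assume x: "x \<in> carrier_vec n"
    have "?G *\<^sub>v x = N *\<^sub>v (N\<^sup>T *\<^sub>v x)" using x N NT by simp
    then have "(B * ?G) *\<^sub>v x = 0\<^sub>v n"
      using x B G NT BN[of "N\<^sup>T *\<^sub>v x"]
      by (simp add: assoc_mult_mat_vec[of B n n ?G n x] del: assoc_mult_mat)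
    then show "(B * ?G) *\<^sub>v x = 0\<^sub>m n n *\<^sub>v x"
      using x by auto
  qed (use B G in auto)
  \<comment> \<open>\<open>B x\<close> and \<open>N N^T x\<close> are orthogonal with sum zero, so
    both vanish. Then \<open>x\<close> lies in \<open>ker B = range N\<close> while
    \<open>N^T x = 0\<close>, so \<open>x\<close> is orthogonal to itself.\<close>
  have inj: "x = 0\<^sub>v n" if x: "x \<in> carrier_vec n" and 0: "(B + ?G) *\<^sub>v x = 0\<^sub>v n" for x
  proof -
    have Gx: "?G *\<^sub>v x = N *\<^sub>v (N\<^sup>T *\<^sub>v x)" using x N by simp
    have c: "B *\<^sub>v x \<in> carrier_vec n" "?G *\<^sub>v x \<in> carrier_vec n" "N\<^sup>T *\<^sub>v x \<in> carrier_vec m"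
      using x B G N by auto
    have sum: "B *\<^sub>v x + ?G *\<^sub>v x = 0\<^sub>v n"
      using 0 add_mult_distrib_mat_vec[OF B G x] by simp
    have "(?G *\<^sub>v x) \<bullet> (B *\<^sub>v x) = 0"
      using scalar_prod_mult_mat_vec_comm(1)[OF B sym c(2) x] BN[OF c(3)] Gx x by simp
    then have "(?G *\<^sub>v x) \<bullet> (?G *\<^sub>v x) = (?G *\<^sub>v x) \<bullet> (B *\<^sub>v x + ?G *\<^sub>v x)"
      using scalar_prod_add_distrib[OF c(2) c(1) c(2)] by simp
    also have "\<dots> = 0" unfolding sum using c by simp
    finally have Gx0: "?G *\<^sub>v x = 0\<^sub>v n" using scalar_prod_self_eq_0[OF c(2)] by simp
    with sum c have Bx0: "B *\<^sub>v x = 0\<^sub>v n" by simp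
    have "(N\<^sup>T *\<^sub>v x) \<bullet> (N\<^sup>T *\<^sub>v x) = x \<bullet> (?G *\<^sub>v x)"
      using transpose_vec_mult_scalar[OF N c(3) x] Gx by simp
    then have NTx: "N\<^sup>T *\<^sub>v x = 0\<^sub>v m"
      unfolding Gx0 using x scalar_prod_self_eq_0[OF c(3)] by simp
    have "x \<in> mat_range N" using ker mat_kernelI[OF B x Bx0] by simp
    then obtain y where y: "y \<in> carrier_vec m" "x = N *\<^sub>v y"
      unfolding mat_range_def using N by auto
    have "x \<bullet> x = (N\<^sup>T *\<^sub>v x) \<bullet> y"
      using transpose_vec_mult_scalar[OF N y(1) x] y by simp
    then have "x \<bullet> x = 0" unfolding NTx using y by simp
    then show ?thesis using scalar_prod_self_eq_0[OF x] by simp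
  qed
  obtain S where S: "S \<in> carrier_mat n n" "(B + ?G) * S = 1\<^sub>m n"
    using injective_mat_inverse[of "B + ?G" n] B G inj by auto
  \<comment> \<open>Multiplying the identity \<open>(B + ?G) * S = 1\<close> by \<open>B\<close>
    from the left removes the correction, as \<open>B * ?G = 0\<close>.\<close>
  have "B = B * ((B + ?G) * S)" using S B by simp
  also have "\<dots> = (B * B + B * ?G) * S"
    using B G S by (metis add_carrier_mat assoc_mult_mat mult_add_distrib_mat)
  also have "\<dots> = B * (B * S)" unfolding BG using B S by simp
  finally show thesis using that S by metis
qed

text \<open>Penrose's argument: \<open>B X = (B Y)(B X)\<close>, and transposing swaps the symmetric
  factors, which leaves \<open>B Y\<close>; likewise \<open>X B = Y B\<close>. Hence
  \<open>X = X B X = X B Y = Y B Y = Y\<close>.\<close>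

lemma is_pseudo_inverse_unique:
  assumes "is_pseudo_inverse B X" "is_pseudo_inverse B Y"
  shows "X = Y"
proof -
  define n m where "n = dim_row B" and "m = dim_col B"
  have B: "B \<in> carrier_mat n m" and X: "X \<in> carrier_mat m n" and Y: "Y \<in> carrier_mat m n"
    using assms unfolding is_pseudo_inverse_def n_def m_def by auto
  have x: "B * X * B = B" "X * B * X = X" "(B * X)\<^sup>T = B * X" "(X * B)\<^sup>T = X * B"
    and y: "B * Y * B = B" "Y * B * Y = Y" "(B * Y)\<^sup>T = B * Y" "(Y * B)\<^sup>T = Y * B"
    using assms unfolding is_pseudo_inverse_def by auto
  have BX: "B * X \<in> carrier_mat n n" and BY: "B * Y \<in> carrier_mat n n"
    and XB: "X * B \<in> carrier_mat m m" and YB: "Y * B \<in> carrier_mat m m"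
    using B X Y by auto
  have "B * X = (B * Y) * (B * X)"
    using y(1) B X Y BY by (metis assoc_mult_mat)
  also have "\<dots> = ((B * X) * (B * Y))\<^sup>T"
    using transpose_mult[OF BX BY] x y by simp
  also have "(B * X) * (B * Y) = B * Y"
    using x(1) B X Y BX by (metis assoc_mult_mat)
  finally have 1: "B * X = B * Y" using y by simp
  have "X * B = (X * B) * (Y * B)"
    using y(1) B X Y by (metis assoc_mult_mat YB)
  also have "\<dots> = ((Y * B) * (X * B))\<^sup>T"
    using transpose_mult[OF YB XB] x y by simp
  also have "(Y * B) * (X * B) = Y * B"
    using x(1) B X Y by (metis assoc_mult_mat XB)
  finally have 2: "X * B = Y * B" using y by simp
  have "X = X * (B * X)" using x(2) B X by simp
  also have "\<dots> = X * B * Y" unfolding 1 using B X Y by simp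
  also have "\<dots> = Y" unfolding 2 using y by simp
  finally show ?thesis .
qed

text \<open>From \<open>B B S = B\<close> and its transpose, \<open>E = B S\<close> is symmetric and
  idempotent with \<open>B E = E B = B\<close>: the orthogonal projection onto the range of
  \<open>B\<close>. A matrix \<open>X\<close> with \<open>B X = X B = E\<close> and
  \<open>E X = X\<close> satisfies the Penrose conditions, and uniqueness identifies it with the
  \<open>THE\<close> term.\<close>

lemma pseudo_inverse_symmetric:
  assumes B: "B \<in> carrier_mat n n" and sym: "B\<^sup>T = B"
  shows "is_pseudo_inverse B (pseudo_inverse B)"
    and "(pseudo_inverse B)\<^sup>T = pseudo_inverse B"
    and "pseudo_inverse B * B = B * pseudo_inverse B"
proof -
  obtain S where S: "S \<in> carrier_mat n n" and BBS: "B * (B * S) = B"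
    using symmetric_mat_factor_through_square[OF B sym] .
  define E where "E = B * S"
  have E: "E \<in> carrier_mat n n" and ST: "S\<^sup>T \<in> carrier_mat n n"
    using B S E_def by auto
  have "(B * (B * S))\<^sup>T = S\<^sup>T * B * B"
    using B S sym by (simp add: transpose_mult[of B n n "B * S" n] transpose_mult[of B n n S n])
  then have STBB: "S\<^sup>T * B * B = B" unfolding BBS sym by simp
  have "S\<^sup>T * B = S\<^sup>T * (B * E)" unfolding E_def BBS ..
  also have "\<dots> = S\<^sup>T * B * B * S" unfolding E_def
    using B S ST by (simp add: assoc_mult_mat[of _ n n _ n _ n] mult_carrier_mat[of _ n n _ n])
  finally have ES: "E = S\<^sup>T * B" unfolding STBB E_def by simp
  have ET: "E\<^sup>T = E" using ES transpose_mult[OF B S] sym by (simp add: E_def)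
  have BE: "B * E = B" using BBS E_def by simp
  have EB: "E * B = B" using STBB ES by simp
  have EE: "E * E = E" using EB B S E by (metis E_def assoc_mult_mat)
  \<comment> \<open>\<open>S\<close> may act arbitrarily on the kernel of \<open>B\<close>;
    compressing it by \<open>E\<close> removes that part.\<close>
  define X where "X = E * S * E"
  have X: "X \<in> carrier_mat n n" using X_def E S by auto
  have "B * X = (B * E) * S * E"
    unfolding X_def using B E S
    by (simp add: assoc_mult_mat[of _ n n _ n _ n] mult_carrier_mat[of _ n n _ n])
  then have BX: "B * X = E" unfolding BE using E_def EE by simp
  have XTB: "X\<^sup>T * B = E"
    using arg_cong[OF BX, of transpose_mat] transpose_mult[OF B X] sym ET by simp
  have EX: "E * X = X" unfolding X_def using E S EE by (metis assoc_mult_mat mult_carrier_mat)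
  have "X\<^sup>T * E = (E * X)\<^sup>T" using transpose_mult[OF E X] ET by simp
  then have XTE: "X\<^sup>T * E = X\<^sup>T" using EX by simp
  \<comment> \<open>Symmetry of \<open>S\<close> is not known here, so that of \<open>X\<close> is
    derived from \<open>B X = E\<close> and its transpose.\<close>
  have "X = X\<^sup>T * B * X" using XTB EX by simp
  also have "\<dots> = X\<^sup>T" using B X XTE by (simp add: BX)
  finally have XT: "X\<^sup>T = X" by simp
  have XB: "X * B = E" using XTB XT by simp
  have pi: "is_pseudo_inverse B X"
    unfolding is_pseudo_inverse_def using B X by (simp add: BX XB EB EX ET)
  then have "pseudo_inverse B = X"
    unfolding pseudo_inverse_def using is_pseudo_inverse_unique by blast
  then show "is_pseudo_inverse B (pseudo_inverse B)" "(pseudo_inverse B)\<^sup>T = pseudo_inverse B"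
    "pseudo_inverse B * B = B * pseudo_inverse B"
    using pi XT BX XB by auto
qed

section \<open>Nilpotency of complex matrices without nonzero eigenvalues\<close>

lemma diag_block_mat_zero:
  "diag_block_mat (map (\<lambda>m. 0\<^sub>m m m) ms) = 0\<^sub>m (sum_list ms) (sum_list ms)"
  by (induction ms) (auto simp: Let_def)

text \<open>Over the complex numbers a Jordan form exists. Each of its blocks belongs to the
  eigenvalue 0, so the sum of all block sizes, being at least the size of each block, is an exponent
  that kills them all.\<close>

lemma nilpotent_if_spectrum_subset_0:
  fixes M :: "complex mat"
  assumes M: "M \<in> carrier_mat n n" and spec: "spectrum M \<subseteq> {0}"
  obtains k where "M ^\<^sub>m k = 0\<^sub>m n n"
proof -
  obtain n_as where jnf: "jordan_nf M n_as"
    using char_poly_factorized[OF M] jordan_nf_exists[OF M] by blast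
  obtain P Q where P: "P \<in> carrier_mat n n" and Q: "Q \<in> carrier_mat n n"
    and cp: "char_poly M = (\<Prod>(m, a)\<leftarrow>n_as. [:- a, 1:] ^ m)"
    and pow: "\<And>k. M ^\<^sub>m k = P * jordan_matrix n_as ^\<^sub>m k * Q"
    using jordan_nf_powE[OF M jnf] by blast
  let ?k = "sum_list (map fst n_as)"
  have block: "jordan_block m a ^\<^sub>m ?k = 0\<^sub>m m m" if "(m, a) \<in> set n_as" for m a
  proof -
    have "m \<noteq> 0" using jnf that unfolding jordan_nf_def by force
    then have "poly (char_poly M) a = 0"
      unfolding cp poly_prod_list using that by (force simp: prod_list_zero_iff)
    then have "a = 0" using spec spectrum_root_char_poly[OF M] by auto
    moreover have "m \<le> ?k" using that by (force intro: member_le_sum_list)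
    ultimately show ?thesis by (auto simp: jordan_block_zero_pow intro!: eq_matI)
  qed
  have "jordan_matrix n_as ^\<^sub>m ?k = diag_block_mat (map (\<lambda>m. 0\<^sub>m m m) (map fst n_as))"
    unfolding jordan_matrix_pow using block by (auto intro!: arg_cong[of _ _ diag_block_mat])
  then have J: "jordan_matrix n_as ^\<^sub>m ?k = 0\<^sub>m ?k ?k" by (simp only: diag_block_mat_zero)
  \<comment> \<open>The zero power of the Jordan matrix has side \<open>?k\<close>, which must agree
    with \<open>n\<close> for the product with \<open>P\<close> and \<open>Q\<close>.\<close>
  have "?k = n"
  proof -
    have "similar_mat M (jordan_matrix n_as)" using jnf unfolding jordan_nf_def by blast
    then obtain n' where "M \<in> carrier_mat n' n'" "jordan_matrix n_as \<in> carrier_mat n' n'"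
      using similar_matD[of M "jordan_matrix n_as"] by auto
    then show ?thesis using M by (metis carrier_matD(1) jordan_matrix_dim(1))
  qed
  then have "M ^\<^sub>m ?k = 0\<^sub>m n n" using pow[of ?k] J P Q by simp
  then show thesis by (rule that)
qed

section \<open>Eigenvalues of matrices that are self-adjoint for a weighted inner product\<close>

lemma map_vec_mult_complex_of_real_mat:
  assumes M: "M \<in> carrier_mat n m" and v: "v \<in> carrier_vec m"
  shows "map_vec Re (map_mat complex_of_real M *\<^sub>v v) = M *\<^sub>v map_vec Re v"
    and "map_vec Im (map_mat complex_of_real M *\<^sub>v v) = M *\<^sub>v map_vec Im v"
  using assms by (auto intro!: eq_vecI simp: scalar_prod_def)

text \<open>Symmetry of \<open>K M\<close> says that \<open>M\<close> is self-adjoint for the inner product \<open>x, y \<mapsto> x \<bullet> K y\<close>.\<close>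

locale selfadjoint_mat =
  fixes n :: nat and K M :: "real mat"
  assumes K: "spd_mat n K" and M: "M \<in> carrier_mat n n" and sym: "(K * M)\<^sup>T = K * M"
begin

lemma K_carrier: "K \<in> carrier_mat n n" and K_sym: "K\<^sup>T = K"
  and K_pos: "x \<in> carrier_vec n \<Longrightarrow> x \<noteq> 0\<^sub>v n \<Longrightarrow> 0 < x \<bullet> (K *\<^sub>v x)"
  using K unfolding spd_mat_def by auto

lemma K_nonneg: "x \<in> carrier_vec n \<Longrightarrow> 0 \<le> x \<bullet> (K *\<^sub>v x)"
  using K_pos[of x] K_carrier by (cases "x = 0\<^sub>v n") auto

lemma selfadjoint:
  assumes "x \<in> carrier_vec n" "y \<in> carrier_vec n"
  shows "x \<bullet> (K *\<^sub>v (M *\<^sub>v y)) = y \<bullet> (K *\<^sub>v (M *\<^sub>v x))"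
  using scalar_prod_mult_mat_vec_comm(2)[of "K * M" n x y] K_carrier M sym assms by simp

text \<open>For an eigenvector \<open>a + i b\<close> and eigenvalue \<open>p + i q\<close>,
  comparing \<open>b . K M a\<close> with \<open>a . K M b\<close> gives
  \<open>q (a . K a + b . K b) = 0\<close>, and the bracket is positive. With \<open>q = 0\<close>,
  whichever of \<open>a\<close>, \<open>b\<close> is nonzero is a real eigenvector for
  \<open>p\<close>.\<close>

lemma eigenvalue_real:
  assumes ev: "eigenvalue (map_mat complex_of_real M) \<mu>"
  shows "\<mu> \<in> \<real>" and "eigenvalue M (Re \<mu>)"
proof -
  define p q where "p = Re \<mu>" and "q = Im \<mu>"
  obtain v where v: "v \<in> carrier_vec n" "v \<noteq> 0\<^sub>v n" "map_mat complex_of_real M *\<^sub>v v = \<mu> \<cdot>\<^sub>v v"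
    using ev M unfolding eigenvalue_def eigenvector_def by auto
  define a b where "a = map_vec Re v" and "b = map_vec Im v"
  have a: "a \<in> carrier_vec n" and b: "b \<in> carrier_vec n" using v a_def b_def by auto
  have ne: "a \<noteq> 0\<^sub>v n \<or> b \<noteq> 0\<^sub>v n"
  proof (rule ccontr)
    assume "\<not> ?thesis"
    then have "a $ i = 0 \<and> b $ i = 0" if "i < n" for i using that by simp
    then have "v $ i = 0" if "i < n" for i
      using that v(1) unfolding a_def b_def by (auto simp: complex_eq_iff)
    then show False using v(1,2) by auto
  qed
  have Ma: "M *\<^sub>v a = p \<cdot>\<^sub>v a - q \<cdot>\<^sub>v b"
    using v(1)
    unfolding a_def b_def p_def q_def map_vec_mult_complex_of_real_mat(1)[OF M v(1), symmetric] v(3)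
    by (auto intro!: eq_vecI)
  have Mb: "M *\<^sub>v b = q \<cdot>\<^sub>v a + p \<cdot>\<^sub>v b"
    using v(1)
    unfolding a_def b_def p_def q_def map_vec_mult_complex_of_real_mat(2)[OF M v(1), symmetric] v(3)
    by (auto intro!: eq_vecI simp: algebra_simps)
  have c: "K *\<^sub>v a \<in> carrier_vec n" "K *\<^sub>v b \<in> carrier_vec n" using K_carrier a b by auto
  have "b \<bullet> (K *\<^sub>v (M *\<^sub>v a)) = p * (b \<bullet> (K *\<^sub>v a)) - q * (b \<bullet> (K *\<^sub>v b))"
    unfolding Ma using a b c K_carrier
    by (simp add: mult_minus_distrib_mat_vec[of K n n] scalar_prod_minus_distrib[of b n]
        mult_mat_vec[of K n n])
  moreover have "a \<bullet> (K *\<^sub>v (M *\<^sub>v b)) = q * (a \<bullet> (K *\<^sub>v a)) + p * (a \<bullet> (K *\<^sub>v b))"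
    unfolding Mb using a b c K_carrier
    by (simp add: mult_add_distrib_mat_vec[of K n n] scalar_prod_add_distrib[of a n]
        mult_mat_vec[of K n n])
  moreover have "b \<bullet> (K *\<^sub>v a) = a \<bullet> (K *\<^sub>v b)"
    by (rule scalar_prod_mult_mat_vec_comm(2)[OF K_carrier K_sym b a])
  ultimately have "q * (a \<bullet> (K *\<^sub>v a) + b \<bullet> (K *\<^sub>v b)) = 0"
    using selfadjoint[OF a b] by (simp add: algebra_simps)
  moreover have "0 < a \<bullet> (K *\<^sub>v a) + b \<bullet> (K *\<^sub>v b)"
    using ne K_pos[OF a] K_pos[OF b] K_nonneg[OF a] K_nonneg[OF b] by fastforce
  ultimately have q: "q = 0" by simp
  then show "\<mu> \<in> \<real>" by (simp add: q_def complex_is_Real_iff)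
  have "M *\<^sub>v a = p \<cdot>\<^sub>v a" "M *\<^sub>v b = p \<cdot>\<^sub>v b" using Ma Mb q a b by auto
  then show "eigenvalue M (Re \<mu>)"
    using ne a b M unfolding eigenvalue_def eigenvector_def p_def by auto
qed

text \<open>Self-adjointness turns the \<open>K\<close>-norm of \<open>M x\<close> into the
  \<open>K\<close>-product of \<open>x\<close> with \<open>M (M x)\<close>. Iterating this shows
  that a nilpotent \<open>M\<close> is zero.\<close>

lemma mult_mult_eq_0:
  assumes x: "x \<in> carrier_vec n" and 0: "M *\<^sub>v (M *\<^sub>v x) = 0\<^sub>v n"
  shows "M *\<^sub>v x = 0\<^sub>v n"
proof -
  have Mx: "M *\<^sub>v x \<in> carrier_vec n" using M x by simp
  have "(M *\<^sub>v x) \<bullet> (K *\<^sub>v (M *\<^sub>v x)) = x \<bullet> (K *\<^sub>v (M *\<^sub>v (M *\<^sub>v x)))"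
    by (rule selfadjoint[OF Mx x])
  also have "\<dots> = 0" unfolding 0 using x K_carrier by (simp add: mult_mat_zero_vec)
  finally show ?thesis using K_pos[OF Mx] by auto
qed

lemma nilpotent_imp_zero:
  assumes "M ^\<^sub>m k = 0\<^sub>m n n"
  shows "M = 0\<^sub>m n n"
proof -
  have "M *\<^sub>v x = 0\<^sub>v n" if "x \<in> carrier_vec n" "M ^\<^sub>m k *\<^sub>v x = 0\<^sub>v n" for x
    using that
  proof (induction k arbitrary: x)
    case 0
    then show ?case using M by (simp add: mult_mat_zero_vec)
  next
    case (Suc k)
    have "M *\<^sub>v x \<in> carrier_vec n" using M Suc.prems by simp
    moreover have "M ^\<^sub>m k *\<^sub>v (M *\<^sub>v x) = 0\<^sub>v n"
      using Suc.prems M assoc_mult_mat_vec[OF pow_carrier_mat[OF M] M Suc.prems(1), of k] by simp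
    ultimately show ?case using Suc.IH mult_mult_eq_0[OF Suc.prems(1)] by blast
  qed
  then have "M *\<^sub>v x = 0\<^sub>m n n *\<^sub>v x" if "x \<in> carrier_vec n" for x
    using that assms zero_mult_mat_vec[OF that, of n] by simp
  then show ?thesis using mat_eq_if_mult_mat_vec_eq[OF M, of "0\<^sub>m n n"] by auto
qed

text \<open>Without nonzero complex eigenvalues \<open>M\<close> would be nilpotent, hence zero. So
  the nonzero spectrum is a nonempty finite set of reals and has a minimum; the real eigenvector
  that comes with it is what the lower bound starts from.\<close>

lemma least_nonzero_eigenvalue_exists:
  assumes "M \<noteq> 0\<^sub>m n n"
  obtains l where "is_least_nonzero_eigenvalue M l" "eigenvalue M l" "l \<noteq> 0"
proof -
  let ?MC = "map_mat complex_of_real M"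
  have MC: "?MC \<in> carrier_mat n n" using M by simp
  define S where "S = spectrum ?MC - {0}"
  have "S \<noteq> {}"
  proof
    assume "S = {}"
    then obtain k where "?MC ^\<^sub>m k = 0\<^sub>m n n"
      using nilpotent_if_spectrum_subset_0[OF MC] S_def by blast
    \<comment> \<open>The zero power is carried back to the real matrix by injectivity of the
      entrywise embedding.\<close>
    also have "0\<^sub>m n n = map_mat complex_of_real (0\<^sub>m n n)" by (rule eq_matI) auto
    finally have "map_mat complex_of_real (M ^\<^sub>m k) = map_mat complex_of_real (0\<^sub>m n n)"
      by (simp only: of_real_hom.mat_hom_pow[OF M])
    then have "M ^\<^sub>m k = 0\<^sub>m n n" by (rule of_real_hom.mat_hom_inj)
    then show False using nilpotent_imp_zero assms by blast
  qed
  have fin: "finite S" using card_finite_spectrum[OF MC] S_def by simp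
  have S: "\<mu> \<in> \<real> \<and> eigenvalue M (Re \<mu>) \<and> \<mu> \<noteq> 0" if "\<mu> \<in> S" for \<mu>
    using that eigenvalue_real[of \<mu>] unfolding S_def spectrum_def by auto
  define l where "l = Min (Re ` S)"
  have "l \<in> Re ` S" unfolding l_def using fin \<open>S \<noteq> {}\<close> by (intro Min_in) auto
  then obtain \<mu> where \<mu>: "\<mu> \<in> S" "l = Re \<mu>" by auto
  then have "complex_of_real l = \<mu>" using S[OF \<mu>(1)] by simp
  moreover have "l \<le> Re \<nu>" if "\<nu> \<in> S" for \<nu> unfolding l_def using fin that by simp
  ultimately have "is_least_nonzero_eigenvalue M l"
    unfolding is_least_nonzero_eigenvalue_def S_def[symmetric] Let_def using S \<mu> by auto
  moreover have "l \<noteq> 0" using S[OF \<mu>(1)] \<open>complex_of_real l = \<mu>\<close> by (metis of_real_0)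
  ultimately show thesis using that S[OF \<mu>(1)] \<mu> by simp
qed

end

section \<open>Positive semi-definite matrices, their inverses and pseudo-inverses\<close>

text \<open>Stands in for the Cauchy-Schwarz inequality: where that would be applied, this
  polynomial is nonnegative at a suitably chosen \<open>t\<close>.\<close>

lemma quadratic_form_expand:
  fixes B :: "real mat"
  assumes B: "B \<in> carrier_mat n n" "B\<^sup>T = B" and x: "x \<in> carrier_vec n" and y: "y \<in> carrier_vec n"
  shows "(x + t \<cdot>\<^sub>v y) \<bullet> (B *\<^sub>v (x + t \<cdot>\<^sub>v y))
    = x \<bullet> (B *\<^sub>v x) + 2 * t * (x \<bullet> (B *\<^sub>v y)) + t\<^sup>2 * (y \<bullet> (B *\<^sub>v y))"
proof -
  have c: "B *\<^sub>v x \<in> carrier_vec n" "B *\<^sub>v y \<in> carrier_vec n" using B x y by auto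
  have "B *\<^sub>v (x + t \<cdot>\<^sub>v y) = B *\<^sub>v x + t \<cdot>\<^sub>v (B *\<^sub>v y)"
    using B x y by (simp add: mult_add_distrib_mat_vec[of B n n] mult_mat_vec[of B n n])
  moreover have "y \<bullet> (B *\<^sub>v x) = x \<bullet> (B *\<^sub>v y)"
    by (rule scalar_prod_mult_mat_vec_comm(2)[OF B y x])
  ultimately show ?thesis
    using x y c by (simp add: add_scalar_prod_distrib[of _ n] scalar_prod_add_distrib[of _ n]
        power2_eq_square algebra_simps)
qed

text \<open>Moving from \<open>x\<close> in the direction \<open>w = B x\<close> changes the form by
  \<open>2 t (w . w)\<close> to first order, so a nonzero \<open>w\<close> would make it negative
  for some \<open>t < 0\<close>.\<close>

lemma spsd_mat_kernel:
  assumes B: "spsd_mat n B" and x: "x \<in> carrier_vec n" and 0: "x \<bullet> (B *\<^sub>v x) = 0"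
  shows "B *\<^sub>v x = 0\<^sub>v n"
proof -
  have Bc: "B \<in> carrier_mat n n" and Bs: "B\<^sup>T = B"
    and nonneg: "\<And>y. y \<in> carrier_vec n \<Longrightarrow> 0 \<le> y \<bullet> (B *\<^sub>v y)"
    using B unfolding spsd_mat_def by auto
  define w where "w = B *\<^sub>v x"
  have w: "w \<in> carrier_vec n" using Bc x w_def by simp
  define b where "b = w \<bullet> (B *\<^sub>v w)"
  define c where "c = w \<bullet> w"
  have b: "0 \<le> b" using nonneg[OF w] b_def by simp
  have xBw: "x \<bullet> (B *\<^sub>v w) = c"
    using scalar_prod_mult_mat_vec_comm(1)[OF Bc Bs x w] by (simp add: c_def w_def)
  \<comment> \<open>The denominator is positive even for \<open>b = 0\<close>, and with this choice
    the value of the form becomes \<open>- t^2 (b + 2)\<close>, which forces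
    \<open>t = 0\<close>.\<close>
  define t where "t = - c / (b + 1)"
  have "0 \<le> (x + t \<cdot>\<^sub>v w) \<bullet> (B *\<^sub>v (x + t \<cdot>\<^sub>v w))" using nonneg x w by simp
  also have "\<dots> = 2 * t * c + t\<^sup>2 * b"
    unfolding quadratic_form_expand[OF Bc Bs x w] 0 xBw b_def by simp
  also have "\<dots> = - (t\<^sup>2 * (b + 2))"
  proof -
    have c: "c = - t * (b + 1)" unfolding t_def using b by simp
    show ?thesis unfolding c by (simp add: power2_eq_square algebra_simps)
  qed
  finally have "t\<^sup>2 * (b + 2) \<le> 0" by simp
  then have "t = 0" using b by (simp add: mult_le_0_iff)
  then have "c = 0" using b unfolding t_def by simp
  then show ?thesis using scalar_prod_self_eq_0[OF w] by (simp add: c_def w_def)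
qed

text \<open>Since \<open>X = X B X\<close> with \<open>X\<close> symmetric, the form of
  \<open>X\<close> at \<open>x\<close> is that of \<open>B\<close> at \<open>X x\<close>.\<close>

lemma spsd_pseudo_inverse:
  assumes B: "spsd_mat n B"
  shows "spsd_mat n (pseudo_inverse B)"
proof -
  let ?X = "pseudo_inverse B"
  have Bc: "B \<in> carrier_mat n n" and Bs: "B\<^sup>T = B"
    and nonneg: "\<And>y. y \<in> carrier_vec n \<Longrightarrow> 0 \<le> y \<bullet> (B *\<^sub>v y)"
    using B unfolding spsd_mat_def by auto
  note pi = pseudo_inverse_symmetric[OF Bc Bs]
  have X: "?X \<in> carrier_mat n n" and XBX: "?X * B * ?X = ?X"
    using pi(1) Bc unfolding is_pseudo_inverse_def by auto
  have "0 \<le> x \<bullet> (?X *\<^sub>v x)" if x: "x \<in> carrier_vec n" for x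
  proof -
    have Xx: "?X *\<^sub>v x \<in> carrier_vec n" using X x by simp
    have "?X *\<^sub>v x = (?X * B * ?X) *\<^sub>v x" unfolding XBX ..
    also have "\<dots> = ?X *\<^sub>v (B *\<^sub>v (?X *\<^sub>v x))"
      by (rule mult_mult_mat_vec[OF X Bc X x])
    finally have "x \<bullet> (?X *\<^sub>v x) = x \<bullet> (?X *\<^sub>v (B *\<^sub>v (?X *\<^sub>v x)))" by simp
    also have "\<dots> = (?X *\<^sub>v x) \<bullet> (B *\<^sub>v (?X *\<^sub>v x))"
      using scalar_prod_mult_mat_vec_comm(1)[OF X pi(2) x, of "B *\<^sub>v (?X *\<^sub>v x)"] Bc Xx by simp
    finally show ?thesis using nonneg[OF Xx] by simp
  qed
  then show ?thesis unfolding spsd_mat_def using X pi(2) by blast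
qed

text \<open>Writing \<open>x = B (K x)\<close> expresses the form of \<open>K\<close> through that
  of \<open>B\<close>. Applied to \<open>H\<close>, this supplies the inner product for which
  \<open>H A P\<close> is self-adjoint.\<close>

lemma spd_mat_inverse:
  assumes B: "spsd_mat n B" and inv: "invertible_mat B"
  obtains K where "spd_mat n K" "K * B = 1\<^sub>m n" "B * K = 1\<^sub>m n"
proof -
  have Bc: "B \<in> carrier_mat n n" and Bs: "B\<^sup>T = B"
    and nonneg: "\<And>y. y \<in> carrier_vec n \<Longrightarrow> 0 \<le> y \<bullet> (B *\<^sub>v y)"
    using B unfolding spsd_mat_def by auto
  obtain K where KB: "K * B = 1\<^sub>m (dim_row K)" and BK: "B * K = 1\<^sub>m n"
    using inv Bc unfolding invertible_mat_def inverts_mat_def by auto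
  \<comment> \<open>\<open>invertible_mat\<close> leaves the shape of the inverse open; comparing
    column numbers in the two identities determines it.\<close>
  have "dim_row K = n" "dim_col K = n"
    using arg_cong[OF KB, of dim_col] arg_cong[OF BK, of dim_col] Bc by simp_all
  then have K: "K \<in> carrier_mat n n" and KB: "K * B = 1\<^sub>m n" using KB by auto
  have BKx: "B *\<^sub>v (K *\<^sub>v x) = x" if "x \<in> carrier_vec n" for x
    using that assoc_mult_mat_vec[OF Bc K that] BK by simp
  have form: "x \<bullet> (K *\<^sub>v y) = (K *\<^sub>v y) \<bullet> (B *\<^sub>v (K *\<^sub>v x))"
    if "x \<in> carrier_vec n" "y \<in> carrier_vec n" for x y
    using that BKx[of x] K comm_scalar_prod[of x n "K *\<^sub>v y"] by simp
  have "K\<^sup>T = K"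
  proof (rule symmetric_matI[OF K])
    fix x y :: "real vec" assume x: "x \<in> carrier_vec n" and y: "y \<in> carrier_vec n"
    have "K *\<^sub>v x \<in> carrier_vec n" "K *\<^sub>v y \<in> carrier_vec n" using K x y by auto
    then show "x \<bullet> (K *\<^sub>v y) = y \<bullet> (K *\<^sub>v x)"
      using form[OF x y] form[OF y x] scalar_prod_mult_mat_vec_comm(2)[OF Bc Bs] by simp
  qed
  moreover have "0 < x \<bullet> (K *\<^sub>v x)" if x: "x \<in> carrier_vec n" and "x \<noteq> 0\<^sub>v n" for x
  proof -
    have Kx: "K *\<^sub>v x \<in> carrier_vec n" using K x by simp
    have "B *\<^sub>v (K *\<^sub>v x) \<noteq> 0\<^sub>v n" using BKx x that by simp
    then have "(K *\<^sub>v x) \<bullet> (B *\<^sub>v (K *\<^sub>v x)) \<noteq> 0" using spsd_mat_kernel[OF B Kx] by blast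
    then show ?thesis using nonneg[OF Kx] form[OF x x] by simp
  qed
  ultimately show thesis using that K KB BK unfolding spd_mat_def by blast
qed

section \<open>Finite sums, and a matrix description of the coarse space\<close>

text \<open>Both claims go through one induction, because additivity in its step needs the partial
  sum to be in the carrier.\<close>

lemma finsum_mat_carrier_scalar_prod:
  fixes F :: "'i \<Rightarrow> real mat"
  assumes "finite I" and "\<And>i. i \<in> I \<Longrightarrow> F i \<in> carrier_mat n m"
    and x: "x \<in> carrier_vec n" and y: "y \<in> carrier_vec m"
  shows "finsum (module_mat TYPE(real) n m) F I \<in> carrier_mat n m \<and>
    x \<bullet> (finsum (module_mat TYPE(real) n m) F I *\<^sub>v y) = (\<Sum>i\<in>I. x \<bullet> (F i *\<^sub>v y))"
proof -
  interpret abelian_group "module_mat TYPE(real) n m" by (rule abelian_group_mat)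
  show ?thesis
    using assms(1,2)
  proof (induction I)
    case empty
    have "0\<^sub>m n m *\<^sub>v y = 0\<^sub>v n" using y by auto
    then show ?case using x by (simp add: module_mat_simps)
  next
    case (insert i I)
    let ?f = "finsum (module_mat TYPE(real) n m) F"
    have F: "F i \<in> carrier_mat n m" "?f I \<in> carrier_mat n m"
      and "F \<in> I \<rightarrow> carrier_mat n m" using insert by auto
    then have "?f (insert i I) = F i + ?f I"
      using finsum_insert[of I i F] insert.hyps by (simp add: module_mat_simps)
    moreover have "x \<bullet> ((F i + ?f I) *\<^sub>v y) = x \<bullet> (F i *\<^sub>v y) + x \<bullet> (?f I *\<^sub>v y)"
      unfolding add_mult_distrib_mat_vec[OF F y]
      using F y by (intro scalar_prod_add_distrib[OF x]) auto
    ultimately show ?case using insert F by simp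
  qed
qed

lemma finsum_vec_carrier_scalar_prod:
  fixes f :: "'i \<Rightarrow> real vec"
  assumes "\<And>i. i \<in> I \<Longrightarrow> f i \<in> carrier_vec n" and x: "x \<in> carrier_vec n"
  shows "finsum_vec TYPE(real) n f I \<bullet> x = (\<Sum>i\<in>I. f i \<bullet> x)"
proof -
  interpret vec_space "TYPE(real)" n .
  show ?thesis using finsum_scalar_prod_sum[of f I x] assms by auto
qed

text \<open>The family that is \<open>v\<close> at \<open>i\<close> and zero elsewhere is a witness.
  This brings the kernel assumption, stated for the whole sum, down to a single subdomain.\<close>

lemma in_sum_of_sets:
  assumes i: "i \<in> I" "finite I" and v: "v \<in> W i" "v \<in> carrier_vec n"
    and 0: "\<And>j. j \<in> I \<Longrightarrow> 0\<^sub>v n \<in> W j"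
  shows "v \<in> sum_of_sets n I W"
proof -
  define w where "w j = (if j = i then v else 0\<^sub>v n)" for j
  have wc: "w \<in> I \<rightarrow> carrier_vec n" using v w_def by auto
  have "finsum_vec TYPE(real) n w I = v"
  proof (rule eq_vecI)
    fix k assume k: "k < dim_vec v"
    then have "finsum_vec TYPE(real) n w I $ k = (\<Sum>j\<in>I. w j $ k)"
      using v by (intro index_finsum_vec[OF i(2) _ wc]) auto
    also have "\<dots> = (\<Sum>j\<in>I. if j = i then v $ k else 0)"
      using k v by (intro sum.cong) (auto simp: w_def)
    finally show "finsum_vec TYPE(real) n w I $ k = v $ k" using i by simp
  qed (use finsum_vec_closed[OF wc] v in auto)
  moreover have "\<forall>j\<in>I. w j \<in> W j" using v 0 w_def by auto
  ultimately show ?thesis unfolding sum_of_sets_def by (auto intro!: exI[of _ w])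
qed

text \<open>Span and independence, given relative to the subspace \<open>V0\<close>, are carried
  over to the ambient space and read as range and injectivity of \<open>R0\<^sup>T\<close>.\<close>

lemma coarse_setting_basis_mat:
  assumes "coarse_setting n V0 R0"
  obtains m where "R0 \<in> carrier_mat m n" "V0 = mat_range R0\<^sup>T"
    "\<forall>y \<in> carrier_vec m. R0\<^sup>T *\<^sub>v y = 0\<^sub>v n \<longrightarrow> y = 0\<^sub>v m"
proof -
  interpret vec_space "TYPE(real)" n .
  let ?W = "V\<lparr>carrier := V0\<rparr>"
  define m where "m = vectorspace.dim class_ring ?W"
  have sub: "VectorSpace.subspace class_ring V0 V" and R0: "R0 \<in> carrier_mat m n"
    and basis: "vectorspace.basis class_ring ?W (set (rows R0))"
    using assms unfolding coarse_setting_def Let_def m_def by auto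
  have submod: "submodule class_ring V0 V" using sub unfolding VectorSpace.subspace_def by simp
  interpret W: vectorspace class_ring ?W
    using sub by (rule subspace_is_vs)
  have b: "W.lin_indpt (set (rows R0))" "W.span (set (rows R0)) = V0" "set (rows R0) \<subseteq> V0"
    using basis unfolding W.basis_def by auto
  have li: "lin_indpt (set (rows R0))" and span: "span (set (rows R0)) = V0"
    using span_li_not_depend[OF b(3) submod] b by auto
  \<comment> \<open>A basis given as a set does not see repeated rows. A repetition would destroy
    injectivity of \<open>R0\<^sup>T\<close>; the number of rows, equal to the dimension, excludes
    it.\<close>
  have "m = card (set (rows R0))" using W.dim_basis[OF _ basis] m_def by simp
  then have dist: "distinct (rows R0)" using R0 by (intro card_distinct) simp
  have R0T: "R0\<^sup>T \<in> carrier_mat n m" using R0 by simp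
  have "V0 = row_space R0" using span unfolding row_space_def by simp
  then have range: "V0 = mat_range R0\<^sup>T"
    unfolding row_space_eq[OF R0] mat_range_def using mult_mat_vec_carrier[OF R0T] R0 by auto
  have "y = 0\<^sub>v m" if "y \<in> carrier_vec m" "R0\<^sup>T *\<^sub>v y = 0\<^sub>v n" for y
    using lin_depI[OF R0T that(1) _ that(2)] li dist by auto
  then show thesis using that R0 range by blast
qed

section \<open>The coarse projection, the Schwarz operator and the local residuals\<close>

locale schwarz_setting =
  fixes n N :: nat and d :: "nat \<Rightarrow> nat"
    and A R0 :: "real mat" and R At :: "nat \<Rightarrow> real mat" and V0 :: "real vec set"
  assumes A: "spd_mat n A"
    and loc: "local_setting n N d R At"
    and coarse: "coarse_setting n V0 R0"
    and ker: "sum_of_sets n {1..N} (\<lambda>s. (\<lambda>z. (R s)\<^sup>T *\<^sub>v z) ` mat_kernel (At s)) \<subseteq> V0"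
begin

abbreviation "P \<equiv> coarse_proj n A R0"
abbreviation "H \<equiv> schwarz_op n N R At"

lemma A_carrier: "A \<in> carrier_mat n n" and A_sym: "A\<^sup>T = A"
  and A_pos: "x \<in> carrier_vec n \<Longrightarrow> x \<noteq> 0\<^sub>v n \<Longrightarrow> 0 < x \<bullet> (A *\<^sub>v x)"
  using A unfolding spd_mat_def by auto

lemma local_ops:
  assumes "s \<in> {1..N}"
  shows "R s \<in> carrier_mat (d s) n" "spsd_mat (d s) (At s)"
    "At s \<in> carrier_mat (d s) (d s)" "(At s)\<^sup>T = At s"
    "pseudo_inverse (At s) \<in> carrier_mat (d s) (d s)"
  using assms loc spsd_pseudo_inverse[of "d s" "At s"] unfolding local_setting_def spsd_mat_def by auto

text \<open>All four facts rest on the inverse \<open>Z\<close> of the Galerkin matrix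
  \<open>R0 A R0^T\<close>, which exists because \<open>A\<close> is positive definite and
  \<open>R0\<^sup>T\<close> is injective. \<open>P_form\<close> packs idempotence and
  \<open>A\<close>-self-adjointness of \<open>P\<close> into one identity.\<close>

lemma coarse_proj_props:
  shows P_carrier: "P \<in> carrier_mat n n"
    and P_V0: "v \<in> V0 \<Longrightarrow> P *\<^sub>v v = 0\<^sub>v n"
    and P_ker: "v \<in> carrier_vec n \<Longrightarrow> P *\<^sub>v v = 0\<^sub>v n \<Longrightarrow> v \<in> V0"
    and P_form: "x \<in> carrier_vec n \<Longrightarrow> y \<in> carrier_vec n \<Longrightarrow>
      x \<bullet> (A *\<^sub>v (P *\<^sub>v y)) = (P *\<^sub>v x) \<bullet> (A *\<^sub>v (P *\<^sub>v y))"
proof -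
  obtain m where R0: "R0 \<in> carrier_mat m n" and V0: "V0 = mat_range R0\<^sup>T"
    and inj: "\<forall>y \<in> carrier_vec m. R0\<^sup>T *\<^sub>v y = 0\<^sub>v n \<longrightarrow> y = 0\<^sub>v m"
    using coarse_setting_basis_mat[OF coarse] .
  have R0T: "R0\<^sup>T \<in> carrier_mat n m" using R0 by simp
  let ?E = "R0 * A * R0\<^sup>T"
  have E: "?E \<in> carrier_mat m m" by (rule mult_carrier_mat[OF mult_carrier_mat[OF R0 A_carrier] R0T])
  have E_apply: "?E *\<^sub>v y = R0 *\<^sub>v (A *\<^sub>v (R0\<^sup>T *\<^sub>v y))" if "y \<in> carrier_vec m" for y
    by (rule mult_mult_mat_vec[OF R0 A_carrier R0T that])
  have E_inj: "y = 0\<^sub>v m" if y: "y \<in> carrier_vec m" and 0: "?E *\<^sub>v y = 0\<^sub>v m" for y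
  proof (rule inj[rule_format, OF y], rule ccontr)
    let ?x = "R0\<^sup>T *\<^sub>v y"
    have x: "?x \<in> carrier_vec n" "A *\<^sub>v ?x \<in> carrier_vec n" using R0T A_carrier y by auto
    assume "?x \<noteq> 0\<^sub>v n"
    then have "0 < ?x \<bullet> (A *\<^sub>v ?x)" using A_pos x by blast
    also have "\<dots> = y \<bullet> (?E *\<^sub>v y)"
      unfolding E_apply[OF y] by (rule transpose_vec_mult_scalar[OF R0 x(2) y])
    also have "\<dots> = 0" unfolding 0 using y by simp
    finally show False by simp
  qed
  obtain Z where Z: "Z \<in> carrier_mat m m" "?E * Z = 1\<^sub>m m" "mat_inverse ?E = Some Z"
    using injective_mat_inverse[OF E E_inj] by blast
  have ZE: "Z * ?E = 1\<^sub>m m" using mat_inverse(2)[OF E Z(3)] by simp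
  have P_def: "P = 1\<^sub>m n - R0\<^sup>T * Z * R0 * A" unfolding coarse_proj_def Z(3) by simp
  have R0TZ: "R0\<^sup>T * Z \<in> carrier_mat n m" by (rule mult_carrier_mat[OF R0T Z(1)])
  have Q: "R0\<^sup>T * Z * R0 * A \<in> carrier_mat n n"
    by (rule mult_carrier_mat[OF mult_carrier_mat[OF R0TZ R0] A_carrier])
  show Pc: "P \<in> carrier_mat n n" unfolding P_def by (rule minus_carrier_mat[OF Q])
  have Q_apply: "(R0\<^sup>T * Z * R0 * A) *\<^sub>v x = R0\<^sup>T *\<^sub>v (Z *\<^sub>v (R0 *\<^sub>v (A *\<^sub>v x)))"
    if x: "x \<in> carrier_vec n" for x
  proof -
    have "R0 *\<^sub>v (A *\<^sub>v x) \<in> carrier_vec m" using R0 A_carrier x by auto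
    then show ?thesis
      unfolding mult_mult_mat_vec[OF R0TZ R0 A_carrier x] by (rule assoc_mult_mat_vec[OF R0T Z(1)])
  qed
  \<comment> \<open>Coordinates, in the basis of rows of \<open>R0\<close>, of the
    \<open>A\<close>-orthogonal projection of \<open>x\<close> onto \<open>V0\<close>.\<close>
  define u where "u x = Z *\<^sub>v (R0 *\<^sub>v (A *\<^sub>v x))" for x
  have u: "u x \<in> carrier_vec m" if "x \<in> carrier_vec n" for x
    unfolding u_def using that R0 Z(1) A_carrier by auto
  have P_apply: "P *\<^sub>v x = x - R0\<^sup>T *\<^sub>v u x" if "x \<in> carrier_vec n" for x
    unfolding P_def u_def using minus_mult_distrib_mat_vec[OF one_carrier_mat Q that] Q_apply[OF that] that
    by simp
  \<comment> \<open>Galerkin orthogonality: the range of \<open>P\<close> is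
    \<open>A\<close>-orthogonal to \<open>V0\<close>.\<close>
  have RAP: "R0 *\<^sub>v (A *\<^sub>v (P *\<^sub>v x)) = 0\<^sub>v m" if x: "x \<in> carrier_vec n" for x
  proof -
    have c: "R0\<^sup>T *\<^sub>v u x \<in> carrier_vec n" "A *\<^sub>v x \<in> carrier_vec n" "R0 *\<^sub>v (A *\<^sub>v x) \<in> carrier_vec m"
      "A *\<^sub>v (R0\<^sup>T *\<^sub>v u x) \<in> carrier_vec n"
      using u[OF x] R0 R0T A_carrier x by auto
    have "R0 *\<^sub>v (A *\<^sub>v (P *\<^sub>v x)) = R0 *\<^sub>v (A *\<^sub>v x) - ?E *\<^sub>v u x"
      unfolding P_apply[OF x] E_apply[OF u[OF x]]
      using mult_minus_distrib_mat_vec[OF A_carrier x c(1)] mult_minus_distrib_mat_vec[OF R0 c(2,4)] by simp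
    also have "?E *\<^sub>v u x = (?E * Z) *\<^sub>v (R0 *\<^sub>v (A *\<^sub>v x))"
      unfolding u_def using assoc_mult_mat_vec[OF E Z(1) c(3)] by simp
    finally show ?thesis unfolding Z(2) using c by simp
  qed
  show "P *\<^sub>v v = 0\<^sub>v n" if "v \<in> V0"
  proof -
    obtain y where y: "y \<in> carrier_vec m" "v = R0\<^sup>T *\<^sub>v y"
      using \<open>v \<in> V0\<close> R0 unfolding V0 mat_range_def by auto
    have v: "v \<in> carrier_vec n" using y R0T by simp
    have "u v = (Z * ?E) *\<^sub>v y"
      unfolding u_def y(2) using E_apply[OF y(1)] assoc_mult_mat_vec[OF Z(1) E y(1)] by simp
    then have "u v = y" unfolding ZE using y by simp
    then show ?thesis using P_apply[OF v] y(2) v by simp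
  qed
  show "v \<in> V0" if v: "v \<in> carrier_vec n" and 0: "P *\<^sub>v v = 0\<^sub>v n"
  proof -
    have c: "R0\<^sup>T *\<^sub>v u v \<in> carrier_vec n" using u[OF v] R0T by simp
    have "v = R0\<^sup>T *\<^sub>v u v"
      by (rule minus_vec_eq_0[OF v c]) (use P_apply[OF v] 0 in simp)
    then show ?thesis using u[OF v] R0 unfolding V0 mat_range_def by auto
  qed
  show "x \<bullet> (A *\<^sub>v (P *\<^sub>v y)) = (P *\<^sub>v x) \<bullet> (A *\<^sub>v (P *\<^sub>v y))"
    if x: "x \<in> carrier_vec n" and y: "y \<in> carrier_vec n"
  proof -
    let ?a = "A *\<^sub>v (P *\<^sub>v y)"
    have c: "?a \<in> carrier_vec n" "R0\<^sup>T *\<^sub>v u x \<in> carrier_vec n" using A_carrier Pc y R0T u[OF x] by auto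
    have "(R0\<^sup>T *\<^sub>v u x) \<bullet> ?a = u x \<bullet> (R0 *\<^sub>v ?a)"
      by (rule transpose_vec_mult_scalar[OF R0 c(1) u[OF x]])
    also have "\<dots> = 0" unfolding RAP[OF y] using u[OF x] by simp
    finally show ?thesis
      unfolding P_apply[OF x] using minus_scalar_prod_distrib[OF x c(2) c(1)] by simp
  qed
qed

text \<open>By \<open>P_form\<close> both sides are values of the symmetric form of \<open>A\<close>
  at \<open>P x\<close> and \<open>P y\<close>.\<close>

lemma AP_sym: "(A * P)\<^sup>T = A * P"
proof (rule symmetric_matI)
  show "A * P \<in> carrier_mat n n" using A_carrier P_carrier by simp
  fix x y :: "real vec" assume x: "x \<in> carrier_vec n" and y: "y \<in> carrier_vec n"
  have "P *\<^sub>v x \<in> carrier_vec n" "P *\<^sub>v y \<in> carrier_vec n" using P_carrier x y by auto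
  then show "x \<bullet> ((A * P) *\<^sub>v y) = y \<bullet> ((A * P) *\<^sub>v x)"
    using P_form[OF x y] P_form[OF y x] scalar_prod_mult_mat_vec_comm(2)[OF A_carrier A_sym]
      A_carrier P_carrier x y by simp
qed

lemma schwarz_op_form:
  assumes x: "x \<in> carrier_vec n" and y: "y \<in> carrier_vec n"
  shows "x \<bullet> (H *\<^sub>v y) = (\<Sum>s = 1..N. (R s *\<^sub>v x) \<bullet> (pseudo_inverse (At s) *\<^sub>v (R s *\<^sub>v y)))"
    and "H \<in> carrier_mat n n"
proof -
  let ?F = "\<lambda>s. (R s)\<^sup>T * pseudo_inverse (At s) * R s"
  have F: "?F s \<in> carrier_mat n n" if "s \<in> {1..N}" for s
    using local_ops(1,5)[OF that]
    by (intro mult_carrier_mat[of _ _ "d s"]) auto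
  note f = finsum_mat_carrier_scalar_prod[of "{1..N}" ?F n n x y, OF _ F x y, folded schwarz_op_def]
  then show "H \<in> carrier_mat n n" by simp
  have "x \<bullet> (?F s *\<^sub>v y) = (R s *\<^sub>v x) \<bullet> (pseudo_inverse (At s) *\<^sub>v (R s *\<^sub>v y))"
    if s: "s \<in> {1..N}" for s
  proof -
    note l = local_ops[OF s]
    let ?w = "pseudo_inverse (At s) *\<^sub>v (R s *\<^sub>v y)"
    have RT: "(R s)\<^sup>T \<in> carrier_mat n (d s)" and w: "?w \<in> carrier_vec (d s)" using l y by auto
    have "?F s *\<^sub>v y = (R s)\<^sup>T *\<^sub>v ?w"
      by (rule mult_mult_mat_vec[OF RT l(5) l(1) y])
    then show ?thesis
      using transpose_vec_mult_scalar[OF RT w x] by simp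
  qed
  then show "x \<bullet> (H *\<^sub>v y) = (\<Sum>s = 1..N. (R s *\<^sub>v x) \<bullet> (pseudo_inverse (At s) *\<^sub>v (R s *\<^sub>v y)))"
    using f by simp
qed

lemma H_spsd: "spsd_mat n H"
proof -
  have H: "H \<in> carrier_mat n n" using schwarz_op_form(2)[of "0\<^sub>v n" "0\<^sub>v n"] by simp
  have pinv: "spsd_mat (d s) (pseudo_inverse (At s))" if "s \<in> {1..N}" for s
    using spsd_pseudo_inverse local_ops[OF that] by blast
  have "H\<^sup>T = H"
  proof (rule symmetric_matI[OF H])
    fix x y :: "real vec" assume xy: "x \<in> carrier_vec n" "y \<in> carrier_vec n"
    show "x \<bullet> (H *\<^sub>v y) = y \<bullet> (H *\<^sub>v x)"
      unfolding schwarz_op_form(1)[OF xy] schwarz_op_form(1)[OF xy(2,1)]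
    proof (rule sum.cong[OF refl])
      fix s assume s: "s \<in> {1..N}"
      then show "(R s *\<^sub>v x) \<bullet> (pseudo_inverse (At s) *\<^sub>v (R s *\<^sub>v y))
        = (R s *\<^sub>v y) \<bullet> (pseudo_inverse (At s) *\<^sub>v (R s *\<^sub>v x))"
        using pinv[OF s] local_ops[OF s] xy unfolding spsd_mat_def
        by (intro scalar_prod_mult_mat_vec_comm(2)) auto
    qed
  qed
  moreover have "0 \<le> x \<bullet> (H *\<^sub>v x)" if x: "x \<in> carrier_vec n" for x
    unfolding schwarz_op_form(1)[OF x x]
  proof (rule sum_nonneg)
    fix s assume s: "s \<in> {1..N}"
    then show "0 \<le> (R s *\<^sub>v x) \<bullet> (pseudo_inverse (At s) *\<^sub>v (R s *\<^sub>v x))"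
      using pinv[OF s] local_ops[OF s] x unfolding spsd_mat_def by auto
  qed
  ultimately show ?thesis unfolding spsd_mat_def using H by blast
qed

lemma H_carrier: "H \<in> carrier_mat n n"
  using H_spsd unfolding spsd_mat_def by simp

text \<open>\<open>R\<^sub>s A P v\<close> is orthogonal to \<open>Ker At\<^sub>s\<close>, because \<open>R\<^sub>s\<^sup>T Ker At\<^sub>s \<subseteq> V0 = Ker P\<close>;
  hence it lies in the range of \<open>At\<^sub>s\<close>.\<close>

lemma local_residual_in_range:
  assumes s: "s \<in> {1..N}" and v: "v \<in> carrier_vec n"
  defines "b \<equiv> R s *\<^sub>v (A *\<^sub>v (P *\<^sub>v v))"
  shows "At s *\<^sub>v (pseudo_inverse (At s) *\<^sub>v b) = b"
proof -
  note l = local_ops[OF s]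
  let ?X = "pseudo_inverse (At s)"
  have a: "A *\<^sub>v (P *\<^sub>v v) \<in> carrier_vec n" using A_carrier P_carrier v by auto
  have b: "b \<in> carrier_vec (d s)" unfolding b_def using l a by simp
  define w where "w = ?X *\<^sub>v b"
  have w: "w \<in> carrier_vec (d s)" using w_def l b by simp
  \<comment> \<open>The residual \<open>t\<close> is shown to lie in the kernel of
    \<open>At s\<close> and to be orthogonal to both \<open>b\<close> and \<open>At s w\<close>,
    hence to itself.\<close>
  define t where "t = b - At s *\<^sub>v w"
  have Aw: "At s *\<^sub>v w \<in> carrier_vec (d s)" using l w by simp
  have t: "t \<in> carrier_vec (d s)" using t_def b Aw by simp
  \<comment> \<open>A symmetric matrix commutes with its pseudo-inverse, which reduces this product
    to a Penrose identity; it yields \<open>At s t = 0\<close>.\<close>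
  have "At s * (At s * ?X) = At s * ?X * At s"
    using pseudo_inverse_symmetric(3)[OF l(3,4)] assoc_mult_mat[OF l(3,5,3)] by simp
  also have "\<dots> = At s"
    using pseudo_inverse_symmetric(1)[OF l(3,4)] unfolding is_pseudo_inverse_def by simp
  finally have AAX: "At s * (At s * ?X) = At s" .
  have "At s *\<^sub>v (At s *\<^sub>v w) = (At s * (At s * ?X)) *\<^sub>v b"
    unfolding w_def using mult_mult_mat_vec[OF l(3,3,5) b] assoc_mult_mat[OF l(3,3,5)] by simp
  then have "At s *\<^sub>v t = 0\<^sub>v (d s)"
    unfolding t_def AAX using mult_minus_distrib_mat_vec[OF l(3) b Aw] l b by simp
  then have tk: "t \<in> mat_kernel (At s)" and At: "At s *\<^sub>v t = 0\<^sub>v (d s)" using mat_kernelI[OF l(3) t] by auto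
  have RT: "(R s)\<^sup>T \<in> carrier_mat n (d s)" using l by simp
  have RTt: "(R s)\<^sup>T *\<^sub>v t \<in> carrier_vec n" using RT t by simp
  have "(R s)\<^sup>T *\<^sub>v t \<in> sum_of_sets n {1..N} (\<lambda>s. (\<lambda>z. (R s)\<^sup>T *\<^sub>v z) ` mat_kernel (At s))"
  proof (rule in_sum_of_sets[OF s])
    fix j assume j: "j \<in> {1..N}"
    note l = local_ops[OF j]
    have "0\<^sub>v (d j) \<in> mat_kernel (At j)"
      using l by (intro mat_kernelI[OF l(3)]) (simp_all add: mult_mat_zero_vec)
    moreover have "0\<^sub>v n = (R j)\<^sup>T *\<^sub>v 0\<^sub>v (d j)" using l by (simp add: mult_mat_zero_vec[of _ n "d j"])
    ultimately show "0\<^sub>v n \<in> (\<lambda>z. (R j)\<^sup>T *\<^sub>v z) ` mat_kernel (At j)" by blast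
  qed (use tk RTt in auto)
  then have P0: "P *\<^sub>v ((R s)\<^sup>T *\<^sub>v t) = 0\<^sub>v n" using ker P_V0 by blast
  \<comment> \<open>After moving \<open>R s\<close> to the other side, \<open>P_form\<close> puts a
    \<open>P\<close> in front of \<open>(R s)\<^sup>T t\<close>, an element of
    \<open>V0\<close>.\<close>
  have "t \<bullet> b = ((R s)\<^sup>T *\<^sub>v t) \<bullet> (A *\<^sub>v (P *\<^sub>v v))"
    unfolding b_def using transpose_vec_mult_scalar[OF l(1) a t] by simp
  also have "\<dots> = 0" unfolding P_form[OF RTt v] P0 using a by simp
  finally have tb: "t \<bullet> b = 0" .
  have "t \<bullet> (At s *\<^sub>v w) = 0"
    using scalar_prod_mult_mat_vec_comm(1)[OF l(3,4) t w] At w by simp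
  then have "t \<bullet> t = 0"
    using scalar_prod_minus_distrib[OF t b Aw] tb unfolding t_def[symmetric] by simp
  then have "t = 0\<^sub>v (d s)" using scalar_prod_self_eq_0[OF t] by simp
  then show ?thesis
    using minus_vec_eq_0[OF b Aw] unfolding t_def w_def by simp
qed

section \<open>The lower bound for nonzero eigenvalues, and their existence\<close>

lemma eigenvalue_ge:
  assumes C0: "C0 > 0"
    and decomp: "\<forall>x \<in> mat_range P. \<exists>z. (\<forall>s \<in> {1..N}. z s \<in> carrier_vec (d s)) \<and>
       x = finsum_vec TYPE(real) n (\<lambda>s. P *\<^sub>v ((R s)\<^sup>T *\<^sub>v z s)) {1..N} \<and>
       (\<Sum>s = 1..N. z s \<bullet> (At s *\<^sub>v z s)) \<le> C0\<^sup>2 * (x \<bullet> (A *\<^sub>v x))"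
    and ev: "eigenvalue (H * A * P) l" and l: "l \<noteq> 0"
  shows "l \<ge> 1 / C0\<^sup>2"
proof -
  have HAP: "H * A * P \<in> carrier_mat n n"
    by (rule mult_carrier_mat[OF mult_carrier_mat[OF H_carrier A_carrier] P_carrier])
  obtain v where v: "v \<in> carrier_vec n" "v \<noteq> 0\<^sub>v n" "(H * A * P) *\<^sub>v v = l \<cdot>\<^sub>v v"
    using ev HAP unfolding eigenvalue_def eigenvector_def by auto
  define x where "x = P *\<^sub>v v"
  define a where "a = A *\<^sub>v x"
  have x: "x \<in> carrier_vec n" and a: "a \<in> carrier_vec n"
    unfolding x_def a_def using A_carrier P_carrier v by auto
  have Ha: "H *\<^sub>v a = l \<cdot>\<^sub>v v"
    unfolding a_def x_def v(3)[symmetric]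
    by (rule mult_mult_mat_vec[OF H_carrier A_carrier P_carrier v(1), symmetric])
  \<comment> \<open>Otherwise \<open>l v = H A x = 0\<close> although \<open>l\<close> and
    \<open>v\<close> are nonzero. This makes the energy \<open>e\<close> positive, so that it can be
    cancelled at the end.\<close>
  have "x \<noteq> 0\<^sub>v n"
  proof
    assume "x = 0\<^sub>v n"
    then have "l \<cdot>\<^sub>v v = 0\<^sub>v n"
      using Ha A_carrier H_carrier by (simp add: a_def mult_mat_zero_vec)
    then have "inverse l \<cdot>\<^sub>v (l \<cdot>\<^sub>v v) = 0\<^sub>v n" by auto
    then show False using v(2) l by (simp add: smult_smult_assoc)
  qed
  define e where "e = x \<bullet> a"
  have e: "0 < e" using A_pos[OF x \<open>x \<noteq> 0\<^sub>v n\<close>] e_def a_def by simp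
  have "x \<in> mat_range P" unfolding mat_range_def x_def using v(1) P_carrier by auto
  then obtain z where z: "\<And>s. s \<in> {1..N} \<Longrightarrow> z s \<in> carrier_vec (d s)"
    and xz: "x = finsum_vec TYPE(real) n (\<lambda>s. P *\<^sub>v ((R s)\<^sup>T *\<^sub>v z s)) {1..N}"
    and bound: "(\<Sum>s = 1..N. z s \<bullet> (At s *\<^sub>v z s)) \<le> C0\<^sup>2 * e"
    using decomp unfolding e_def a_def by blast
  define w where "w s = pseudo_inverse (At s) *\<^sub>v (R s *\<^sub>v a)" for s
  have w: "w s \<in> carrier_vec (d s)" and Aw: "At s *\<^sub>v w s = R s *\<^sub>v a" if "s \<in> {1..N}" for s
    using local_ops[OF that] a local_residual_in_range[OF that v(1)]
    unfolding w_def a_def x_def by auto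
  have RTz: "(R s)\<^sup>T *\<^sub>v z s \<in> carrier_vec n" if "s \<in> {1..N}" for s
    using local_ops(1)[OF that] z[OF that] by simp
  have "e = (\<Sum>s = 1..N. (P *\<^sub>v ((R s)\<^sup>T *\<^sub>v z s)) \<bullet> a)"
    unfolding e_def
    by (subst xz, rule finsum_vec_carrier_scalar_prod[OF _ a]) (use RTz P_carrier in auto)
  also have "\<dots> = (\<Sum>s = 1..N. z s \<bullet> (At s *\<^sub>v w s))"
  proof (rule sum.cong[OF refl])
    fix s assume s: "s \<in> {1..N}"
    have "(P *\<^sub>v ((R s)\<^sup>T *\<^sub>v z s)) \<bullet> a = ((R s)\<^sup>T *\<^sub>v z s) \<bullet> a"
      unfolding a_def x_def using P_form[OF RTz[OF s] v(1)] by simp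
    also have "\<dots> = z s \<bullet> (R s *\<^sub>v a)"
      by (rule transpose_vec_mult_scalar[OF local_ops(1)[OF s] a z[OF s]])
    finally show "(P *\<^sub>v ((R s)\<^sup>T *\<^sub>v z s)) \<bullet> a = z s \<bullet> (At s *\<^sub>v w s)" using Aw[OF s] by simp
  qed
  finally have zw: "(\<Sum>s = 1..N. z s \<bullet> (At s *\<^sub>v w s)) = e" by simp
  have "(\<Sum>s = 1..N. w s \<bullet> (At s *\<^sub>v w s)) = (\<Sum>s = 1..N. (R s *\<^sub>v a) \<bullet> w s)"
  proof (rule sum.cong[OF refl])
    fix s assume s: "s \<in> {1..N}"
    show "w s \<bullet> (At s *\<^sub>v w s) = (R s *\<^sub>v a) \<bullet> w s"
      unfolding Aw[OF s] using w[OF s] local_ops(1)[OF s] a by (intro comm_scalar_prod) auto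
  qed
  also have "\<dots> = a \<bullet> (H *\<^sub>v a)" unfolding schwarz_op_form(1)[OF a a] w_def ..
  also have "\<dots> = l * (v \<bullet> a)" unfolding Ha using a v(1) comm_scalar_prod[of a n v] by simp
  also have "v \<bullet> a = e" unfolding e_def a_def x_def by (rule P_form[OF v(1) v(1)])
  finally have ww: "(\<Sum>s = 1..N. w s \<bullet> (At s *\<^sub>v w s)) = l * e" .
  \<comment> \<open>The local forms are nonnegative at \<open>z s - c (w s)\<close>. Summing gives
    \<open>c e - 2 c e + c^2 l e \<ge> 0\<close>, that is \<open>c e (c l - 1) \<ge> 0\<close>; the
    weight \<open>c\<close> is chosen so that exactly the claimed bound remains.\<close>
  define c where "c = C0\<^sup>2"
  have c: "0 < c" using C0 c_def by simp
  have "0 \<le> (\<Sum>s = 1..N. z s \<bullet> (At s *\<^sub>v z s) + 2 * (- c) * (z s \<bullet> (At s *\<^sub>v w s))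
    + (- c)\<^sup>2 * (w s \<bullet> (At s *\<^sub>v w s)))"
  proof (rule sum_nonneg)
    fix s assume s: "s \<in> {1..N}"
    have "0 \<le> (z s + (- c) \<cdot>\<^sub>v w s) \<bullet> (At s *\<^sub>v (z s + (- c) \<cdot>\<^sub>v w s))"
      using local_ops(2)[OF s] z[OF s] w[OF s] unfolding spsd_mat_def by simp
    then show "0 \<le> z s \<bullet> (At s *\<^sub>v z s) + 2 * (- c) * (z s \<bullet> (At s *\<^sub>v w s))
      + (- c)\<^sup>2 * (w s \<bullet> (At s *\<^sub>v w s))"
      unfolding quadratic_form_expand[OF local_ops(3,4)[OF s] z[OF s] w[OF s]] .
  qed
  also have "\<dots> = (\<Sum>s = 1..N. z s \<bullet> (At s *\<^sub>v z s)) + 2 * (- c) * e + (- c)\<^sup>2 * (l * e)"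
    by (simp only: sum.distrib zw ww flip: sum_distrib_left)
  also have "\<dots> \<le> c * e + 2 * (- c) * e + (- c)\<^sup>2 * (l * e)"
    using bound unfolding c_def by (simp only: add_right_mono)
  finally have "0 \<le> (c * e) * (c * l - 1)" by (simp add: power2_eq_square algebra_simps)
  moreover have "0 < c * e" using c e by simp
  ultimately have "0 \<le> c * l - 1" by (metis mult_le_cancel_left_pos mult_zero_right)
  then have "1 \<le> c * l" by simp
  then show ?thesis using c unfolding c_def by (simp add: field_simps)
qed

text \<open>A vector outside \<open>V0 = Ker P\<close> has a nonzero image under \<open>P\<close>,
  and both \<open>A\<close> and \<open>H\<close> are injective.\<close>

lemma HAP_nonzero:
  assumes "V0 \<noteq> carrier_vec n"
  shows "H * A * P \<noteq> 0\<^sub>m n n"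
proof
  assume 0: "H * A * P = 0\<^sub>m n n"
  obtain K where K: "spd_mat n K" "K * H = 1\<^sub>m n"
    using spd_mat_inverse[OF H_spsd] loc unfolding local_setting_def by blast
  have V0c: "V0 \<subseteq> carrier_vec n"
    using coarse mult_mat_vec_carrier[of "R0\<^sup>T"]
    unfolding coarse_setting_def VectorSpace.subspace_def submodule_def by (auto simp: module_vec_simps)
  with assms obtain x where x: "x \<in> carrier_vec n" "x \<notin> V0" by blast
  let ?y = "P *\<^sub>v x"
  have y: "?y \<in> carrier_vec n" "?y \<noteq> 0\<^sub>v n" using P_ker x P_carrier by auto
  have "H *\<^sub>v (A *\<^sub>v ?y) = (H * A * P) *\<^sub>v x"
    by (rule mult_mult_mat_vec[OF H_carrier A_carrier P_carrier x(1), symmetric])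
  also have "\<dots> = 0\<^sub>v n" unfolding 0 by (rule zero_mult_mat_vec[OF x(1)])
  finally have "H *\<^sub>v (A *\<^sub>v ?y) = 0\<^sub>v n" .
  moreover have "A *\<^sub>v ?y \<in> carrier_vec n" using A_carrier y by simp
  moreover have "K \<in> carrier_mat n n" using K unfolding spd_mat_def by simp
  ultimately have "A *\<^sub>v ?y = 0\<^sub>v n"
    using assoc_mult_mat_vec[of K n n H n "A *\<^sub>v ?y"] K(2) H_carrier by (simp add: mult_mat_zero_vec)
  then show False using A_pos[OF y] y(1) by simp
qed

end

text \<open>For \<open>V0 = carrier_vec n\<close> the projection and with it \<open>H A P\<close>
  vanish, so there is no nonzero eigenvalue to speak of; this is why the conclusion is conditional
  on a proper coarse space.\<close>

theorem lemma15:
  fixes n N :: nat and d :: "nat \<Rightarrow> nat"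
    and A R0 :: "real mat" and R At :: "nat \<Rightarrow> real mat"
    and V0 :: "real vec set" and C0 :: real
  assumes "spd_mat n A"
    and "local_setting n N d R At"
    and "coarse_setting n V0 R0"
    and "sum_of_sets n {1..N} (\<lambda>s. (\<lambda>z. (R s)\<^sup>T *\<^sub>v z) ` mat_kernel (At s)) \<subseteq> V0"
    and "C0 > 0"
    and "\<forall>x \<in> mat_range (coarse_proj n A R0).
           \<exists>z. (\<forall>s \<in> {1..N}. z s \<in> carrier_vec (d s)) \<and>
               x = finsum_vec TYPE(real) n (\<lambda>s. coarse_proj n A R0 *\<^sub>v ((R s)\<^sup>T *\<^sub>v z s)) {1..N} \<and>
               (\<Sum>s = 1..N. z s \<bullet> (At s *\<^sub>v z s)) \<le> C0\<^sup>2 * (x \<bullet> (A *\<^sub>v x))"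
  shows "V0 \<noteq> carrier_vec n \<longrightarrow>
           (\<exists>lmin. is_least_nonzero_eigenvalue (schwarz_op n N R At * A * coarse_proj n A R0) lmin \<and>
                   lmin \<ge> 1 / C0\<^sup>2)"
proof
  assume V0: "V0 \<noteq> carrier_vec n"
  interpret schwarz_setting n N d A R0 R At V0
    using assms(1-4) by unfold_locales
  obtain K where K: "spd_mat n K" and KH: "K * H = 1\<^sub>m n"
    using spd_mat_inverse[OF H_spsd] assms(2) unfolding local_setting_def by blast
  have Kc: "K \<in> carrier_mat n n" using K unfolding spd_mat_def by simp
  have AP: "A * P \<in> carrier_mat n n" by (rule mult_carrier_mat[OF A_carrier P_carrier])
  have M: "H * A * P = H * (A * P)"
    by (rule assoc_mult_mat[OF H_carrier A_carrier P_carrier])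
  \<comment> \<open>With \<open>K\<close> the inverse of \<open>H\<close>, self-adjointness of
    \<open>H A P\<close> for the \<open>K\<close>-inner product amounts to symmetry of
    \<open>A P\<close>.\<close>
  have KM: "K * (H * A * P) = A * P"
    unfolding M assoc_mult_mat[OF Kc H_carrier AP, symmetric] KH by (rule left_mult_one_mat[OF AP])
  interpret selfadjoint_mat n K "H * A * P"
  proof
    show "H * A * P \<in> carrier_mat n n"
      by (rule mult_carrier_mat[OF mult_carrier_mat[OF H_carrier A_carrier] P_carrier])
    show "(K * (H * A * P))\<^sup>T = K * (H * A * P)" unfolding KM by (rule AP_sym)
  qed (rule K)
  obtain l where "is_least_nonzero_eigenvalue (H * A * P) l" "eigenvalue (H * A * P) l" "l \<noteq> 0"
    using least_nonzero_eigenvalue_exists[OF HAP_nonzero[OF V0]] .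
  moreover from this have "l \<ge> 1 / C0\<^sup>2"
    using eigenvalue_ge[OF assms(5,6)] by blast
  ultimately show "\<exists>lmin. is_least_nonzero_eigenvalue (H * A * P) lmin \<and> lmin \<ge> 1 / C0\<^sup>2"
    by blast
qed

end
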